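(* Let $k\geq 4$ and $n>k$ be integers. If $G$ is a $2$-connected graph on $n$ vertices with chromatic number $\chi(G)=k$ and clique number $\omega(G)=k$, then for every integer $x\geq k$, $$P(G,x)\leq (x-1)_{k-1}\big((x-1)^{n-k+1}+(-1)^{n-k}\big),$$ with equality if and only if $G\cong G_{n,k}$.
   Context: All graphs are finite and simple. $P(G,x)$ denotes the chromatic polynomial of $G$, i.e., for a positive integer $x$ the number of proper colorings $c:V(G)\to\{1,\dots,x\}$. $(x)_m=x(x-1)\cdots(x-m+1)$ denotes the falling factorial. $G_{n,k}$ is the graph on $n$ vertices obtained from a $k$-clique by adding a path with $n-k$ new internal vertices (each of degree $2$) whose two endpoints are two distinct vertices of the clique. *)

theory Defs
  imports Complex_Main "HOL-Library.FuncSet" "HOL-Library.Ramsey"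
begin

record 'a sgraph =
  verts :: "'a set"
  edges :: "'a set set"

definition simple_graph :: "'a sgraph \<Rightarrow> bool" where
  "simple_graph G \<longleftrightarrow> finite (verts G) \<and> edges G \<subseteq> [verts G]\<^bsup>2\<^esup>"

definition delete_verts :: "'a sgraph \<Rightarrow> 'a set \<Rightarrow> 'a sgraph" where
  "delete_verts G X =
     \<lparr>verts = verts G - X, edges = {e \<in> edges G. e \<inter> X = {}}\<rparr>"

definition connected_graph :: "'a sgraph \<Rightarrow> bool" where
  "connected_graph G \<longleftrightarrow> verts G \<noteq> {} \<and>
     (\<forall>u\<in>verts G. \<forall>v\<in>verts G. (u, v) \<in> {(a, b). {a, b} \<in> edges G}\<^sup>*)"

definition vertex_connected :: "nat \<Rightarrow> 'a sgraph \<Rightarrow> bool" where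
  "vertex_connected r G \<longleftrightarrow> card (verts G) > r \<and>
     (\<forall>X\<subseteq>verts G. card X < r \<longrightarrow> connected_graph (delete_verts G X))"

definition proper_colorings :: "'a sgraph \<Rightarrow> nat \<Rightarrow> ('a \<Rightarrow> nat) set" where
  "proper_colorings G x =
     {c \<in> verts G \<rightarrow>\<^sub>E {1..x}. \<forall>u v. {u, v} \<in> edges G \<longrightarrow> c u \<noteq> c v}"

text \<open>The chromatic polynomial is only evaluated at natural numbers, where its value is by
  definition the number of proper colorings.\<close>

definition chromatic_poly :: "'a sgraph \<Rightarrow> nat \<Rightarrow> nat" where
  "chromatic_poly G x = card (proper_colorings G x)"

definition chromatic_number :: "'a sgraph \<Rightarrow> nat" where
  "chromatic_number G = (LEAST m. proper_colorings G m \<noteq> {})"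

definition clique_number :: "'a sgraph \<Rightarrow> nat" where
  "clique_number G = Max {card K | K. K \<subseteq> verts G \<and> clique K (edges G)}"

definition graph_iso :: "'a sgraph \<Rightarrow> 'b sgraph \<Rightarrow> bool" where
  "graph_iso G H \<longleftrightarrow> (\<exists>f. bij_betw f (verts G) (verts H) \<and>
     (\<forall>u\<in>verts G. \<forall>v\<in>verts G. {u, v} \<in> edges G \<longleftrightarrow> {f u, f v} \<in> edges H))"

definition falling_factorial :: "int \<Rightarrow> nat \<Rightarrow> int" where
  "falling_factorial x m = (\<Prod>i<m. x - int i)"

definition path_edges :: "'a list \<Rightarrow> 'a set set" where
  "path_edges p = {{p ! i, p ! Suc i} | i. Suc i < length p}"

text \<open>The graph obtained from a clique on \<open>0, \<dots>, k - 1\<close> by adding the path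
  \<open>0, k, k + 1, \<dots>, n - 1, 1\<close>; meaningful for \<open>2 \<le> k < n\<close>. By symmetry of the clique the
  choice of the two attachment vertices is immaterial up to isomorphism.\<close>

definition clique_with_path :: "nat \<Rightarrow> nat \<Rightarrow> nat sgraph" where
  "clique_with_path n k =
     \<lparr>verts = {..<n}, edges = [{..<k}]\<^bsup>2\<^esup> \<union> path_edges ([0] @ [k..<n] @ [1])\<rparr>"

end

theory Submission
  imports Defs
begin

text \<open>Let \<open>K\<close> be a maximum clique and \<open>q = x - 1\<close>. By 2-connectedness \<open>G\<close> has a spanning
  subgraph \<open>H\<close> that arises from \<open>K\<close> by successively adding open ears with at least one internal
  vertex. Adding an ear with \<open>b\<close> internal vertices and ends \<open>u, v\<close> gives
  \<open>P(H + ear) = P(H) D\<^sub>b - (- 1)\<^sup>b S\<close>, where \<open>S\<close> counts the colorings of \<open>H\<close> in which \<open>u\<close> and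
  \<open>v\<close> agree and \<open>(q + 1) D\<^sub>b = q ^ (b + 1) + (- 1) ^ b\<close>. For the first ear \<open>S = 0\<close>, and the
  bound holds with equality. If \<open>H\<close> has \<open>a \<ge> 1\<close> vertices outside \<open>K\<close>, then connectedness gives
  \<open>S \<le> (x)\<^sub>k q ^ (a - 1)\<close>, and \<open>D\<^sub>a D\<^sub>b + q ^ (a - 1) < D\<^bsub>a + b\<^esub>\<close> makes the bound strict.
  Finally, if \<open>H\<close> is a clique with one ear, any two nonadjacent vertices agree in some coloring,
  so every additional edge of \<open>G\<close> strictly decreases the number of colorings.\<close>

section \<open>Edges of a path given by its list of vertices\<close>

lemma path_edges_Nil [simp]: "path_edges [] = {}"
  and path_edges_single [simp]: "path_edges [a] = {}"
  by (auto simp: path_edges_def)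

lemma path_edges_Cons_Cons [simp]:
  "path_edges (a # b # l) = insert {a, b} (path_edges (b # l))"
proof (intro equalityI subsetI)
  fix e assume "e \<in> path_edges (a # b # l)"
  then obtain i where "Suc i < length (a # b # l)" "e = {(a # b # l) ! i, (a # b # l) ! Suc i}"
    by (auto simp: path_edges_def)
  then show "e \<in> insert {a, b} (path_edges (b # l))"
    by (cases i) (auto simp: path_edges_def)
next
  fix e assume "e \<in> insert {a, b} (path_edges (b # l))"
  then consider "e = {a, b}" | i where "Suc i < length (b # l)" "e = {(b # l) ! i, (b # l) ! Suc i}"
    by (auto simp: path_edges_def)
  then show "e \<in> path_edges (a # b # l)"
  proof cases
    case 1
    then show ?thesis unfolding path_edges_def by (intro CollectI exI[of _ 0]) auto
  next
    case 2
    then show ?thesis unfolding path_edges_def by (intro CollectI exI[of _ "Suc i"]) auto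
  qed
qed

text \<open>Both pieces keep the cut vertex \<open>y\<close>, so no edge is lost. This is how paths
  are later split at a chosen vertex.\<close>

lemma path_edges_append:
  "path_edges (xs @ y # ys) = path_edges (xs @ [y]) \<union> path_edges (y # ys)"
proof (induction xs)
  case (Cons a xs)
  then show ?case by (cases xs) auto
qed simp

lemma path_edges_map: "path_edges (map f l) = (`) f ` path_edges l"
proof (induction l)
  case (Cons a l)
  then show ?case by (cases l) auto
qed simp

lemma path_edges_subset_nsets:
  "distinct l \<Longrightarrow> path_edges l \<subseteq> [set l]\<^bsup>2\<^esup>"
  by (auto simp: path_edges_def nth_eq_iff_index_eq)

section \<open>Graph operations and the arithmetic of walk counts\<close>

definition complete_graph :: "'a set \<Rightarrow> 'a sgraph" where
  "complete_graph K = \<lparr>verts = K, edges = [K]\<^bsup>2\<^esup>\<rparr>"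

definition add_pendant :: "'a sgraph \<Rightarrow> 'a \<Rightarrow> 'a \<Rightarrow> 'a sgraph" where
  "add_pendant H u w = \<lparr>verts = insert w (verts H), edges = insert {u, w} (edges H)\<rparr>"

text \<open>The list \<open>p\<close> holds the internal vertices only. With \<open>p = []\<close>
  the operation adds just the edge from \<open>u\<close> to \<open>v\<close>, which is the base case
  of the inductions along an ear.\<close>

definition add_ear :: "'a sgraph \<Rightarrow> 'a \<Rightarrow> 'a list \<Rightarrow> 'a \<Rightarrow> 'a sgraph" where
  "add_ear H u p v = \<lparr>verts = verts H \<union> set p, edges = edges H \<union> path_edges (u # p @ [v])\<rparr>"

text \<open>For nonadjacent \<open>s\<close> and \<open>t\<close> these are the colorings of the
  graph with \<open>s\<close> and \<open>t\<close> identified. They replace contraction in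
  deletion-contraction without changing the vertex set.\<close>

definition agreeing_colorings :: "'a sgraph \<Rightarrow> nat \<Rightarrow> 'a \<Rightarrow> 'a \<Rightarrow> ('a \<Rightarrow> nat) set" where
  "agreeing_colorings H x s t = {c \<in> proper_colorings H x. c s = c t}"

text \<open>The number of walks with \<open>m\<close> internal vertices between two given distinct vertices of the
  complete graph on \<open>q + 1\<close> vertices.\<close>

fun walk_count :: "int \<Rightarrow> nat \<Rightarrow> int" where
  "walk_count q 0 = 1"
| "walk_count q (Suc m) = q * walk_count q m + (- 1) ^ Suc m"

text \<open>The factor \<open>q + 1\<close> keeps the formula within the integers. For
  \<open>q = x - 1\<close> it is the factor \<open>x\<close> by which \<open>(x)_k\<close> exceeds
  \<open>(x-1)_(k-1)\<close>.\<close>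

lemma walk_count_closed: "(q + 1) * walk_count q m = q ^ Suc m + (- 1) ^ m"
proof (induction m)
  case (Suc m)
  have "(q + 1) * walk_count q (Suc m) = q * ((q + 1) * walk_count q m) + (q + 1) * (- 1) ^ Suc m"
    by (simp add: algebra_simps)
  then show ?case unfolding Suc by (simp add: algebra_simps)
qed simp

lemma walk_count_nonneg:
  assumes "q \<ge> 1" shows "walk_count q m \<ge> 0"
proof -
  have "(- 1 :: int) ^ m \<ge> - 1"
    by (cases "even m") auto
  moreover have "q ^ Suc m \<ge> 1"
    using assms by (simp add: one_le_power del: power_Suc)
  ultimately have "(q + 1) * walk_count q m \<ge> 0"
    unfolding walk_count_closed by linarith
  then show ?thesis using assms by (simp add: zero_le_mult_iff)
qed

text \<open>Multiplied by \<open>(q + 1)^2\<close>, the gap between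
  \<open>walk_count q (a + b)\<close> and the product factors completely, and each factor has a
  simple lower bound. The assumption on \<open>q\<close> is sharp: for \<open>q = 2\<close>,
  \<open>a = 2\<close>, \<open>b = 1\<close> the two sides are equal.\<close>

lemma walk_count_product_less:
  assumes q: "q \<ge> 3" and a: "a \<ge> 1" and b: "b \<ge> 1"
  shows "q * walk_count q a * walk_count q b + q ^ a < q * walk_count q (a + b)"
proof -
  let ?D = "walk_count q"
  define A B :: int where "A = (- 1) ^ a" and "B = (- 1) ^ b"
  \<comment> \<open>Inserting the closed form makes the leading terms \<open>q^2 * q^a * q^b\<close>
    and the terms \<open>A * B\<close> cancel.\<close>
  have id: "(q + 1)\<^sup>2 * (?D (a + b) - ?D a * ?D b) = q * (q ^ a - A) * (q ^ b - B)"
  proof -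
    have "(q + 1)\<^sup>2 * (?D (a + b) - ?D a * ?D b)
        = (q + 1) * ((q + 1) * ?D (a + b)) - ((q + 1) * ?D a) * ((q + 1) * ?D b)"
      by (simp add: power2_eq_square algebra_simps)
    also have "\<dots> = (q + 1) * (q * q ^ a * q ^ b + A * B) - (q * q ^ a + A) * (q * q ^ b + B)"
      unfolding walk_count_closed by (simp add: A_def B_def power_add)
    also have "\<dots> = q * (q ^ a - A) * (q ^ b - B)"
      by (simp add: algebra_simps)
    finally show ?thesis .
  qed
  have qa: "q ^ a \<ge> q"
    using power_increasing[of 1 a q] q a by simp
  have A: "q ^ a - A \<ge> q ^ a - 1"
    by (cases "even a") (auto simp: A_def)
  \<comment> \<open>The value \<open>q + 1\<close> is attained at \<open>b = 1\<close>. For even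
    \<open>b\<close> the sign is unfavourable, but then \<open>q ^ b\<close> is at least
    \<open>q^2\<close>.\<close>
  have B: "q ^ b - B \<ge> q + 1"
  proof (cases "even b")
    case True
    with b have "b \<ge> 2" by (cases b; cases "b - 1") auto
    then have "q ^ b \<ge> q ^ 2" using power_increasing[of 2 b q] q by simp
    moreover have "q ^ 2 \<ge> 3 * q" using q by (simp add: power2_eq_square)
    moreover have "B = 1" using True by (simp add: B_def)
    ultimately show ?thesis using q by linarith
  next
    case False
    then show ?thesis using power_increasing[of 1 b q] q b by (simp add: B_def)
  qed
  \<comment> \<open>This is the claim with both signed factors replaced by their lower bounds and a
    common factor removed. Since \<open>q ^ a\<close> is at least \<open>q\<close>, it reduces to
    \<open>q^2 - q - 1 > q\<close>, which is where \<open>q >= 3\<close> enters.\<close>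
  have "q ^ a * (q\<^sup>2 - q - 1) - q\<^sup>2 > 0"
  proof -
    have e: "q\<^sup>2 \<ge> 3 * q" using q by (simp add: power2_eq_square)
    then have "q ^ a * (q\<^sup>2 - q - 1) \<ge> q * (q\<^sup>2 - q - 1)"
      using qa q by (intro mult_right_mono) auto
    moreover have "q * (q\<^sup>2 - q - 1) > q * q"
      using e q by (intro mult_strict_left_mono) auto
    ultimately show ?thesis
      unfolding power2_eq_square by linarith
  qed
  then have "q\<^sup>2 * (q ^ a - 1) > q ^ a * (q + 1)"
    by (simp add: algebra_simps)
  then have "q\<^sup>2 * (q ^ a - 1) * (q + 1) > q ^ a * (q + 1) * (q + 1)"
    using q by simp
  moreover have "q * (q * (q ^ a - A) * (q ^ b - B)) \<ge> q * (q * (q ^ a - 1) * (q + 1))"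
    using q qa A B by (intro mult_left_mono mult_mono) auto
  ultimately have "q * ((q + 1)\<^sup>2 * (?D (a + b) - ?D a * ?D b)) > q ^ a * (q + 1) * (q + 1)"
    unfolding id by (simp add: power2_eq_square mult.assoc)
  then have "(q + 1)\<^sup>2 * (q * (?D (a + b) - ?D a * ?D b)) > (q + 1)\<^sup>2 * q ^ a"
    by (simp add: power2_eq_square mult_ac)
  then have "q * (?D (a + b) - ?D a * ?D b) > q ^ a"
    using q by (simp add: mult_less_cancel_left_pos)
  then show ?thesis by (simp add: algebra_simps)
qed

section \<open>Counting colorings after adding a pendant vertex or an ear\<close>

lemma simple_graphD:
  assumes "simple_graph G"
  shows "finite (verts G)" and "{a, b} \<in> edges G \<Longrightarrow> a \<in> verts G \<and> b \<in> verts G \<and> a \<noteq> b"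
  using assms doubleton_in_nsets_2[of a b "verts G"] unfolding simple_graph_def by blast+

lemma finite_proper_colorings:
  "finite (verts G) \<Longrightarrow> finite (proper_colorings G x)"
  unfolding proper_colorings_def by (simp add: finite_PiE)

lemma proper_colorings_antimono:
  assumes "verts H = verts G" and "edges H \<subseteq> edges G"
  shows "proper_colorings G x \<subseteq> proper_colorings H x"
  using assms by (auto simp: proper_colorings_def)

lemma simple_complete_graph: "finite K \<Longrightarrow> simple_graph (complete_graph K)"
  by (simp add: simple_graph_def complete_graph_def)

lemma simple_add_pendant:
  assumes "simple_graph H" "u \<in> verts H" "w \<notin> verts H"
  shows "simple_graph (add_pendant H u w)"
  using assms nsets_mono[of "verts H" "insert w (verts H)" 2]
  by (auto simp: simple_graph_def add_pendant_def)

lemma add_ear_Cons: "add_ear H u (w # p) v = add_ear (add_pendant H u w) w p v"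
  by (auto simp: add_ear_def add_pendant_def)

lemma simple_add_ear:
  assumes "simple_graph H" "u \<in> verts H" "v \<in> verts H" "u \<noteq> v" "distinct p" "set p \<inter> verts H = {}"
  shows "simple_graph (add_ear H u p v)"
proof -
  have "path_edges (u # p @ [v]) \<subseteq> [set (u # p @ [v])]\<^bsup>2\<^esup>"
    using assms by (intro path_edges_subset_nsets) auto
  also have "\<dots> \<subseteq> [verts H \<union> set p]\<^bsup>2\<^esup>"
    using assms by (intro nsets_mono) auto
  finally show ?thesis
    using assms(1) nsets_mono[of "verts H" "verts H \<union> set p" 2]
    by (auto simp: simple_graph_def add_ear_def)
qed

text \<open>A coloring of the larger graph is a coloring \<open>c\<close> of \<open>H\<close>
  together with a color for \<open>w\<close> other than \<open>c u\<close>. The predicate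
  \<open>R\<close> lets one bijection serve both the count of all colorings and the counts of
  agreeing ones.\<close>

lemma card_colorings_add_pendant:
  assumes H: "simple_graph H" and u: "u \<in> verts H" and w: "w \<notin> verts H"
  shows "card {c \<in> proper_colorings (add_pendant H u w) x. R c} =
    (\<Sum>c\<in>proper_colorings H x. card {d \<in> {1..x} - {c u}. R (c(w := d))})"
proof -
  let ?T = "SIGMA c:proper_colorings H x. {d \<in> {1..x} - {c u}. R (c(w := d))}"
  have wu: "w \<noteq> u" using u w by auto
  have e: "a \<noteq> w \<and> b \<noteq> w" if "{a, b} \<in> edges H" for a b
    using simple_graphD(2)[OF H that] w by auto
  have "{c \<in> proper_colorings (add_pendant H u w) x. R c} = (\<lambda>(c, d). c(w := d)) ` ?T"
  proof (intro equalityI subsetI)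
    fix c assume c: "c \<in> {c \<in> proper_colorings (add_pendant H u w) x. R c}"
    \<comment> \<open>Colorings are extensional, so restricting to \<open>H\<close> means resetting
      the value at \<open>w\<close> to \<open>undefined\<close>.\<close>
    let ?c = "c(w := undefined)"
    have "?c \<in> proper_colorings H x"
      using c w e by (auto simp: proper_colorings_def add_pendant_def PiE_iff extensional_def)
    moreover have "c w \<in> {1..x} - {?c u}"
      using c wu by (auto simp: proper_colorings_def add_pendant_def PiE_iff)
    moreover have "c = ?c(w := c w)" by simp
    ultimately show "c \<in> (\<lambda>(c, d). c(w := d)) ` ?T"
      using c by (intro image_eqI[of _ _ "(?c, c w)"]) auto
  next
    fix c' assume "c' \<in> (\<lambda>(c, d). c(w := d)) ` ?T"
    then obtain c d where c: "c \<in> proper_colorings H x" "d \<in> {1..x}" "d \<noteq> c u" "R (c(w := d))"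
      and c': "c' = c(w := d)" by auto
    have "c' a \<noteq> c' b" if "{a, b} \<in> insert {u, w} (edges H)" for a b
      using that c(1,3) c' wu e by (auto simp: proper_colorings_def doubleton_eq_iff)
    moreover have "c' \<in> insert w (verts H) \<rightarrow>\<^sub>E {1..x}"
      using c(1,2) c' by (auto simp: proper_colorings_def PiE_iff extensional_def)
    ultimately show "c' \<in> {c \<in> proper_colorings (add_pendant H u w) x. R c}"
      using c c' by (simp add: proper_colorings_def add_pendant_def)
  qed
  moreover have "inj_on (\<lambda>(c, d). c(w := d)) ?T"
  proof (rule inj_onI)
    fix y z assume "y \<in> ?T" "z \<in> ?T" and "(\<lambda>(c, d). c(w := d)) y = (\<lambda>(c, d). c(w := d)) z"
    then obtain c d c' d' where yz: "y = (c, d)" "z = (c', d')"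
      and *: "c \<in> proper_colorings H x" "c' \<in> proper_colorings H x"
      and eq: "c(w := d) = c'(w := d')" by auto
    \<comment> \<open>Both values are \<open>undefined\<close>, because \<open>w\<close> lies
      outside \<open>H\<close>.\<close>
    have "c w = c' w" using * w by (auto simp: proper_colorings_def PiE_iff extensional_def)
    with eq yz show "y = z"
      by (metis fun_upd_same fun_upd_triv fun_upd_upd)
  qed
  moreover have "finite (proper_colorings H x)"
    using H by (simp add: finite_proper_colorings simple_graphD)
  ultimately show ?thesis by (simp add: card_image)
qed

lemma chromatic_poly_add_pendant:
  assumes "simple_graph H" "u \<in> verts H" "w \<notin> verts H"
  shows "chromatic_poly (add_pendant H u w) x = chromatic_poly H x * (x - 1)"
proof -
  have "card ({1..x} - {c u}) = x - 1" if "c \<in> proper_colorings H x" for c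
    using that assms(2) by (simp add: proper_colorings_def PiE_iff card_Diff_singleton_if)
  then show ?thesis
    using card_colorings_add_pendant[OF assms, of x "\<lambda>_. True"]
    by (simp add: chromatic_poly_def set_diff_eq)
qed

lemma card_agreeing_add_pendant:
  assumes "simple_graph H" "u \<in> verts H" "w \<notin> verts H" "s \<noteq> w" "t \<noteq> w"
  shows "card (agreeing_colorings (add_pendant H u w) x s t)
    = card (agreeing_colorings H x s t) * (x - 1)"
proof -
  have "card {d \<in> {1..x} - {c u}. (c(w := d)) s = (c(w := d)) t} = (if c s = c t then x - 1 else 0)"
    if "c \<in> proper_colorings H x" for c
  proof -
    have "card ({1..x} - {c u}) = x - 1"
      using that assms(2) by (simp add: proper_colorings_def PiE_iff card_Diff_singleton_if)
    then show ?thesis using assms(4,5) by (simp add: set_diff_eq)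
  qed
  then have "card (agreeing_colorings (add_pendant H u w) x s t)
      = (\<Sum>c\<in>proper_colorings H x. if c s = c t then x - 1 else 0)"
    using card_colorings_add_pendant[OF assms(1-3), of x "\<lambda>c. c s = c t"]
    by (simp add: agreeing_colorings_def)
  also have "\<dots> = (\<Sum>c\<in>agreeing_colorings H x s t. x - 1)"
    using assms(1) unfolding agreeing_colorings_def
    by (intro sum.inter_filter[symmetric]) (simp add: finite_proper_colorings simple_graphD)
  finally show ?thesis by simp
qed

text \<open>Giving \<open>w\<close> the color of \<open>v\<close> is possible, in exactly one way,
  when \<open>u\<close> and \<open>v\<close> have different colors, and impossible
  otherwise.\<close>

lemma card_agreeing_pendant_vertex:
  assumes "simple_graph H" "u \<in> verts H" "w \<notin> verts H" "v \<in> verts H"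
  shows "card (agreeing_colorings (add_pendant H u w) x w v) + card (agreeing_colorings H x u v)
    = chromatic_poly H x"
proof -
  have fin: "finite (proper_colorings H x)"
    using assms(1) by (simp add: finite_proper_colorings simple_graphD)
  have vw: "v \<noteq> w" using assms by auto
  have "card {d \<in> {1..x} - {c u}. (c(w := d)) w = (c(w := d)) v} = (if c u \<noteq> c v then 1 else 0)"
    if "c \<in> proper_colorings H x" for c
  proof -
    have "c v \<in> {1..x}" using that assms(4) by (auto simp: proper_colorings_def PiE_iff)
    then have "{d \<in> {1..x} - {c u}. (c(w := d)) w = (c(w := d)) v} = (if c u \<noteq> c v then {c v} else {})"
      using vw by auto
    then show ?thesis by simp
  qed
  then have "card (agreeing_colorings (add_pendant H u w) x w v)
      = (\<Sum>c\<in>proper_colorings H x. if c u \<noteq> c v then 1 else 0)"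
    using card_colorings_add_pendant[OF assms(1-3), of x "\<lambda>c. c w = c v"]
    by (simp add: agreeing_colorings_def)
  also have "\<dots> = card {c \<in> proper_colorings H x. c u \<noteq> c v}"
    using fin by (simp add: sum.inter_filter[symmetric])
  finally have "card (agreeing_colorings (add_pendant H u w) x w v)
      = card {c \<in> proper_colorings H x. c u \<noteq> c v}" .
  moreover have "card {c \<in> proper_colorings H x. c u \<noteq> c v} + card (agreeing_colorings H x u v)
      = card ({c \<in> proper_colorings H x. c u \<noteq> c v} \<union> agreeing_colorings H x u v)"
    using fin by (intro card_Un_disjoint[symmetric]) (auto simp: agreeing_colorings_def)
  moreover have "{c \<in> proper_colorings H x. c u \<noteq> c v} \<union> agreeing_colorings H x u v
      = proper_colorings H x"
    by (auto simp: agreeing_colorings_def)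
  ultimately show ?thesis by (simp add: chromatic_poly_def)
qed

text \<open>The first internal vertex is pendant at \<open>u\<close>, and the rest of the list is an
  ear starting at that vertex; hence the induction generalizes \<open>H\<close> and
  \<open>u\<close>.\<close>

lemma chromatic_poly_add_ear:
  assumes "simple_graph H" "u \<in> verts H" "v \<in> verts H" "distinct p" "set p \<inter> verts H = {}" "x \<ge> 1"
  shows "int (chromatic_poly (add_ear H u p v) x) =
    int (chromatic_poly H x) * walk_count (int x - 1) (length p)
      - (- 1) ^ length p * int (card (agreeing_colorings H x u v))"
  using assms
proof (induction p arbitrary: H u)
  case Nil
  have fin: "finite (proper_colorings H x)"
    using Nil(1) by (simp add: finite_proper_colorings simple_graphD)
  \<comment> \<open>The single closing edge discards exactly the colorings in which its ends
    agree.\<close>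
  have "proper_colorings (add_ear H u [] v) x = proper_colorings H x - agreeing_colorings H x u v"
    by (auto simp: proper_colorings_def add_ear_def agreeing_colorings_def doubleton_eq_iff)
  moreover have "agreeing_colorings H x u v \<subseteq> proper_colorings H x"
    by (auto simp: agreeing_colorings_def)
  ultimately show ?case
    using fin by (simp add: chromatic_poly_def card_Diff_subset finite_subset of_nat_diff card_mono)
next
  case (Cons w p)
  let ?H = "add_pendant H u w"
  have w: "w \<notin> verts H" using Cons.prems by auto
  have "int (chromatic_poly (add_ear ?H w p v) x) =
    int (chromatic_poly ?H x) * walk_count (int x - 1) (length p)
      - (- 1) ^ length p * int (card (agreeing_colorings ?H x w v))"
    using Cons.prems w by (intro Cons.IH simple_add_pendant) (auto simp: add_pendant_def)
  \<comment> \<open>Passing from \<open>u\<close> to \<open>w\<close> replaces the agreement count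
    by its complement. This flips the sign and supplies the summand \<open>(- 1) ^ Suc m\<close> in
    the recursion of \<open>walk_count\<close>.\<close>
  moreover have "int (card (agreeing_colorings ?H x w v))
      = int (chromatic_poly H x) - int (card (agreeing_colorings H x u v))"
    using card_agreeing_pendant_vertex[OF Cons.prems(1,2) w Cons.prems(3), of x] by simp
  moreover have "int (chromatic_poly ?H x) = int (chromatic_poly H x) * (int x - 1)"
    using chromatic_poly_add_pendant[OF Cons.prems(1,2) w, of x] Cons.prems(6)
    by (simp add: of_nat_diff)
  ultimately show ?case
    by (simp add: add_ear_Cons algebra_simps)
qed

section \<open>Complete graphs, crude coloring bounds and graphs built from ears\<close>

lemma falling_factorial_Suc:
  "falling_factorial y (Suc m) = y * falling_factorial (y - 1) m"
  unfolding falling_factorial_def prod.lessThan_Suc_shift by (simp add: algebra_simps)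

lemma falling_factorial_pos:
  "m \<le> x \<Longrightarrow> falling_factorial (int x) m > 0"
  unfolding falling_factorial_def by (intro prod_pos) auto

lemma chromatic_poly_complete_graph:
  assumes "finite K" "card K \<le> x"
  shows "int (chromatic_poly (complete_graph K) x) = falling_factorial (int x) (card K)"
proof -
  have "proper_colorings (complete_graph K) x = {c \<in> K \<rightarrow>\<^sub>E {1..x}. inj_on c K}"
    by (auto simp: proper_colorings_def complete_graph_def inj_on_def)
  then have "chromatic_poly (complete_graph K) x = card {c \<in> K \<rightarrow>\<^sub>E {1..x}. inj_on c K}"
    by (simp add: chromatic_poly_def)
  also have "\<dots> = (\<Prod>i<card K. x - i)"
    using card_inj_on_subset_funcset[of K "{1..x}" K] assms by (simp add: lessThan_atLeast0)
  finally show ?thesis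
    using assms(2) by (auto simp: falling_factorial_def of_nat_diff intro!: prod.cong)
qed

text \<open>Intended for a connected graph with \<open>a\<close> vertices outside a clique that has \<open>F\<close>
  colorings: each of these vertices has at most \<open>x - 1\<close> colors available, and prescribing
  that two vertices agree costs one such factor. The factor \<open>x - 1\<close> stands on the left because
  \<open>a - 1\<close> would be truncated at \<open>a = 0\<close>.\<close>

definition coloring_bounds :: "'a sgraph \<Rightarrow> nat \<Rightarrow> nat \<Rightarrow> nat \<Rightarrow> bool" where
  "coloring_bounds H x F a \<longleftrightarrow> chromatic_poly H x \<le> F * (x - 1) ^ a \<and>
     (\<forall>s\<in>verts H. \<forall>t\<in>verts H. s \<noteq> t \<longrightarrow>
        (x - 1) * card (agreeing_colorings H x s t) \<le> F * (x - 1) ^ a)"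

lemma coloring_bounds_antimono:
  assumes "coloring_bounds H x F a" "verts H = verts G" "edges H \<subseteq> edges G" "finite (verts G)"
  shows "coloring_bounds G x F a"
proof -
  have sub: "proper_colorings G x \<subseteq> proper_colorings H x"
    using assms by (intro proper_colorings_antimono) auto
  have fin: "finite (proper_colorings H x)"
    using assms by (simp add: finite_proper_colorings)
  have "chromatic_poly G x \<le> chromatic_poly H x"
    unfolding chromatic_poly_def by (intro card_mono fin sub)
  moreover have "card (agreeing_colorings G x s t) \<le> card (agreeing_colorings H x s t)" for s t
    unfolding agreeing_colorings_def using fin sub by (intro card_mono) auto
  then have "(x - 1) * card (agreeing_colorings G x s t) \<le> (x - 1) * card (agreeing_colorings H x s t)" for s t
    by (rule mult_le_mono2)
  then have "(x - 1) * card (agreeing_colorings G x s t) \<le> F * (x - 1) ^ a"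
    if "s \<in> verts G" "t \<in> verts G" "s \<noteq> t" for s t
    using that assms(1,2) le_trans unfolding coloring_bounds_def by blast
  ultimately show ?thesis
    using assms(1,2) le_trans unfolding coloring_bounds_def by blast
qed

lemma coloring_bounds_complete_graph:
  "coloring_bounds (complete_graph K) x (chromatic_poly (complete_graph K) x) 0"
proof -
  \<comment> \<open>Emptiness gives the agreement bound already at exponent 0, where no factor
    \<open>x - 1\<close> is available on the right.\<close>
  have "agreeing_colorings (complete_graph K) x s t = {}" if "s \<in> K" "t \<in> K" "s \<noteq> t" for s t
    using that by (auto simp: agreeing_colorings_def complete_graph_def proper_colorings_def)
  then show ?thesis by (simp add: coloring_bounds_def complete_graph_def)
qed

text \<open>For a pair of old vertices, both sides gain a factor \<open>x - 1\<close>. For a pair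
  containing \<open>w\<close>, the color of \<open>w\<close> is determined by the other vertex, so
  the agreement count is at most the number of colorings of \<open>H\<close>.\<close>

lemma coloring_bounds_add_pendant:
  assumes H: "simple_graph H" "u \<in> verts H" "w \<notin> verts H" and b: "coloring_bounds H x F a"
  shows "coloring_bounds (add_pendant H u w) x F (Suc a)"
proof -
  let ?H = "add_pendant H u w"
  have P: "chromatic_poly H x \<le> F * (x - 1) ^ a"
    using b by (simp add: coloring_bounds_def)
  have new: "(x - 1) * card (agreeing_colorings ?H x w t) \<le> F * (x - 1) ^ Suc a"
    if "t \<in> verts H" for t
  proof -
    have "card (agreeing_colorings ?H x w t) \<le> F * (x - 1) ^ a"
      using card_agreeing_pendant_vertex[OF H that, of x] P by linarith
    then have "(x - 1) * card (agreeing_colorings ?H x w t) \<le> (x - 1) * (F * (x - 1) ^ a)"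
      by (rule mult_le_mono2)
    then show ?thesis by (simp add: algebra_simps)
  qed
  have sym: "agreeing_colorings ?H x s t = agreeing_colorings ?H x t s" for s t
    by (auto simp: agreeing_colorings_def)
  have old: "(x - 1) * card (agreeing_colorings ?H x s t) \<le> F * (x - 1) ^ Suc a"
    if "s \<in> verts H" "t \<in> verts H" "s \<noteq> t" for s t
  proof -
    have "(x - 1) * card (agreeing_colorings H x s t) \<le> F * (x - 1) ^ a"
      using b that by (simp add: coloring_bounds_def)
    then have "(x - 1) * card (agreeing_colorings H x s t) * (x - 1) \<le> F * (x - 1) ^ a * (x - 1)"
      by (rule mult_le_mono1)
    moreover have "s \<noteq> w" "t \<noteq> w" using that H by auto
    ultimately show ?thesis
      using card_agreeing_add_pendant[OF H, of s t x] by (simp add: algebra_simps)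
  qed
  have "chromatic_poly ?H x \<le> F * (x - 1) ^ Suc a"
    using mult_le_mono1[OF P, of "x - 1"] chromatic_poly_add_pendant[OF H, of x]
    by (simp add: algebra_simps)
  then show ?thesis
    using new old sym unfolding coloring_bounds_def by (auto simp: add_pendant_def)
qed

text \<open>An ear is a sequence of pendant additions followed by one closing edge, and an
  additional edge can only destroy colorings.\<close>

lemma coloring_bounds_add_ear:
  assumes "simple_graph H" "u \<in> verts H" "v \<in> verts H" "distinct p" "set p \<inter> verts H = {}"
    and "coloring_bounds H x F a"
  shows "coloring_bounds (add_ear H u p v) x F (a + length p)"
  using assms
proof (induction p arbitrary: H u a)
  case Nil
  then show ?case
    using coloring_bounds_antimono[of H x F a "add_ear H u [] v"]
    by (auto simp: add_ear_def simple_graphD)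
next
  case (Cons w p)
  let ?H = "add_pendant H u w"
  have w: "w \<notin> verts H" using Cons.prems by auto
  have "coloring_bounds (add_ear ?H w p v) x F (Suc a + length p)"
    using Cons.prems w
    by (intro Cons.IH simple_add_pendant coloring_bounds_add_pendant) (auto simp: add_pendant_def)
  then show ?case by (simp add: add_ear_Cons)
qed

text \<open>The index counts the ears. Ears without internal vertices are excluded: chords are
  treated as surplus edges of \<open>G\<close>, and every ear enlarges the vertex set.\<close>

inductive built_from_ears :: "'a set \<Rightarrow> nat \<Rightarrow> 'a sgraph \<Rightarrow> bool" for K where
  clique: "built_from_ears K 0 (complete_graph K)"
| ear: "\<lbrakk>built_from_ears K r H; u \<in> verts H; v \<in> verts H; u \<noteq> v; p \<noteq> []; distinct p;
    set p \<inter> verts H = {}\<rbrakk> \<Longrightarrow> built_from_ears K (Suc r) (add_ear H u p v)"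

lemma built_from_ears_0: "built_from_ears K 0 H \<Longrightarrow> H = complete_graph K"
  by (erule built_from_ears.cases) auto

lemma built_from_ears_simple:
  assumes "built_from_ears K r H" "finite K"
  shows "simple_graph H \<and> K \<subseteq> verts H"
  using assms
proof induction
  case clique
  then show ?case using simple_complete_graph[of K] by (simp add: complete_graph_def)
next
  case (ear r H u v p)
  then show ?case using simple_add_ear[of H u v p] by (auto simp: add_ear_def)
qed

lemma card_verts_add_ear:
  assumes "simple_graph H" "distinct p" "set p \<inter> verts H = {}"
  shows "card (verts (add_ear H u p v)) = card (verts H) + length p"
  using assms by (simp add: add_ear_def card_Un_disjoint simple_graphD distinct_card inf_commute)

text \<open>This keeps \<open>card (verts H) - card K\<close> free of truncation and makes it
  positive once there is an ear.\<close>

lemma built_from_ears_card_verts: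
  assumes "built_from_ears K r H" "finite K"
  shows "card (verts H) \<ge> card K + r"
  using assms
proof induction
  case (ear r H u v p)
  then have "length p \<ge> 1" by (cases p) auto
  moreover have "card (verts (add_ear H u p v)) = card (verts H) + length p"
    using ear built_from_ears_simple[of K r H] by (intro card_verts_add_ear) auto
  ultimately show ?case using ear by simp
qed (simp add: complete_graph_def)

lemma built_from_ears_coloring_bounds:
  assumes "built_from_ears K r H" "finite K"
  shows "coloring_bounds H x (chromatic_poly (complete_graph K) x) (card (verts H) - card K)"
  using assms
proof induction
  case clique
  then show ?case using coloring_bounds_complete_graph[of K x] by (simp add: complete_graph_def)
next
  case (ear r H u v p)
  then have H: "simple_graph H" "card (verts H) \<ge> card K"
    using built_from_ears_simple[of K r H] built_from_ears_card_verts[of K r H] by auto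
  then have "card (verts (add_ear H u p v)) - card K = (card (verts H) - card K) + length p"
    using card_verts_add_ear[of H p u v] ear by simp
  then show ?case
    using coloring_bounds_add_ear[of H u v p x _ "card (verts H) - card K"] ear H by simp
qed

section \<open>The upper bound for graphs built from ears\<close>

lemma chromatic_poly_clique_add_ear:
  assumes "finite K" "u \<in> K" "v \<in> K" "u \<noteq> v" "distinct p" "set p \<inter> K = {}" "x \<ge> 1"
  shows "int (chromatic_poly (add_ear (complete_graph K) u p v) x)
    = int (chromatic_poly (complete_graph K) x) * walk_count (int x - 1) (length p)"
proof -
  \<comment> \<open>The ends of a first ear are adjacent in the clique, so the correction term of
    the ear formula vanishes.\<close>
  have "agreeing_colorings (complete_graph K) x u v = {}"
    using assms by (auto simp: agreeing_colorings_def complete_graph_def proper_colorings_def)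
  then show ?thesis
    using chromatic_poly_add_ear[of "complete_graph K" u v p x] assms simple_complete_graph[of K]
    by (simp add: complete_graph_def)
qed

text \<open>The bound for \<open>H\<close> controls the main term of the ear formula, and
  \<open>coloring_bounds\<close> controls its correction term. The estimate is carried out after
  multiplication by \<open>q\<close>, which avoids the exponent \<open>a - 1\<close>.\<close>

lemma chromatic_poly_second_ear_less:
  assumes "built_from_ears K r H" "r \<ge> 1" "finite K" "card K \<le> x" "x \<ge> 4"
    and ear: "u \<in> verts H" "v \<in> verts H" "u \<noteq> v" "p \<noteq> []" "distinct p" "set p \<inter> verts H = {}"
    and bound: "int (chromatic_poly H x) \<le> int (chromatic_poly (complete_graph K) x)
        * walk_count (int x - 1) (card (verts H) - card K)"
  shows "int (chromatic_poly (add_ear H u p v) x) < int (chromatic_poly (complete_graph K) x)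
        * walk_count (int x - 1) (card (verts (add_ear H u p v)) - card K)"
proof -
  define F where "F = int (chromatic_poly (complete_graph K) x)"
  define q where "q = int x - 1"
  define a b where "a = card (verts H) - card K" and "b = length p"
  define S where "S = int (card (agreeing_colorings H x u v))"
  have H: "simple_graph H" "card (verts H) \<ge> card K + r"
    using built_from_ears_simple[of K r H] built_from_ears_card_verts[of K r H] assms(1,3) by auto
  have a: "a \<ge> 1" and b: "b \<ge> 1" using H assms by (auto simp: a_def b_def Suc_le_eq)
  have q: "q \<ge> 3" and q_nat: "int (x - 1) = q" using assms by (simp_all add: q_def of_nat_diff)
  have F: "F > 0"
    unfolding F_def using assms by (simp add: chromatic_poly_complete_graph falling_factorial_pos)
  have S: "q * S \<le> F * q ^ a"
  proof -
    have "(x - 1) * card (agreeing_colorings H x u v) \<le> chromatic_poly (complete_graph K) x * (x - 1) ^ a"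
      using built_from_ears_coloring_bounds[OF assms(1,3), of x] ear
      by (simp add: coloring_bounds_def a_def)
    then have "int ((x - 1) * card (agreeing_colorings H x u v))
        \<le> int (chromatic_poly (complete_graph K) x * (x - 1) ^ a)"
      by (rule of_nat_mono)
    then show ?thesis unfolding of_nat_mult of_nat_power q_nat S_def F_def .
  qed
  \<comment> \<open>The correction increases the count only for odd \<open>b\<close>; the bound by
    \<open>S\<close> covers both parities.\<close>
  have "(- 1 :: int) ^ b * S \<ge> - S"
    by (cases "even b") (auto simp: S_def)
  moreover have "int (chromatic_poly H x) * walk_count q b \<le> F * walk_count q a * walk_count q b"
    using bound q by (intro mult_right_mono walk_count_nonneg) (auto simp: F_def q_def a_def)
  moreover have "int (chromatic_poly (add_ear H u p v) x)
      = int (chromatic_poly H x) * walk_count q b - (- 1) ^ b * S"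
    unfolding S_def b_def q_def using assms H by (intro chromatic_poly_add_ear) auto
  ultimately have "int (chromatic_poly (add_ear H u p v) x) \<le> F * walk_count q a * walk_count q b + S"
    by linarith
  then have "q * int (chromatic_poly (add_ear H u p v) x)
      \<le> q * (F * walk_count q a * walk_count q b + S)"
    using q by (intro mult_left_mono) auto
  also have "\<dots> \<le> F * (q * walk_count q a * walk_count q b + q ^ a)"
    using S by (simp add: algebra_simps)
  also have "\<dots> < F * (q * walk_count q (a + b))"
    using walk_count_product_less[OF q a b] F by simp
  finally have "q * int (chromatic_poly (add_ear H u p v) x) < q * (F * walk_count q (a + b))"
    by (simp add: algebra_simps)
  then have "int (chromatic_poly (add_ear H u p v) x) < F * walk_count q (a + b)"
    using q by simp
  moreover have "card (verts (add_ear H u p v)) - card K = a + b"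
    using card_verts_add_ear[of H p u v] H ear by (simp add: a_def b_def)
  ultimately show ?thesis by (simp add: F_def q_def)
qed

lemma chromatic_poly_built_from_ears:
  assumes "built_from_ears K r H" "finite K" "card K \<le> x" "x \<ge> 4"
  shows "int (chromatic_poly H x) \<le> int (chromatic_poly (complete_graph K) x)
      * walk_count (int x - 1) (card (verts H) - card K) \<and>
    (r \<ge> 2 \<longrightarrow> int (chromatic_poly H x) < int (chromatic_poly (complete_graph K) x)
      * walk_count (int x - 1) (card (verts H) - card K))"
  using assms
proof induction
  case clique
  then show ?case by (simp add: complete_graph_def)
next
  case (ear r H u v p)
  show ?case
  proof (cases "r = 0")
    case True
    then have H: "H = complete_graph K" using ear built_from_ears_0 by blast
    then have "card (verts (add_ear H u p v)) - card K = length p"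
      using card_verts_add_ear[of H p u v] ear simple_complete_graph[of K]
      by (simp add: complete_graph_def)
    then show ?thesis
      using chromatic_poly_clique_add_ear[of K u v p x] ear H True by (simp add: complete_graph_def)
  next
    case False
    then have "int (chromatic_poly (add_ear H u p v) x) < int (chromatic_poly (complete_graph K) x)
        * walk_count (int x - 1) (card (verts (add_ear H u p v)) - card K)"
      using ear by (intro chromatic_poly_second_ear_less[of K r]) auto
    then show ?thesis by simp
  qed
qed

section \<open>Spanning ear constructions in 2-connected graphs\<close>

lemma path_to_set:
  assumes "(a, b) \<in> {(a, b). {a, b} \<in> E}\<^sup>*" "a \<notin> B" "b \<in> B"
  shows "\<exists>p v. distinct (a # p) \<and> set (a # p) \<inter> B = {} \<and> v \<in> B \<and> path_edges (a # p @ [v]) \<subseteq> E"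
  using assms
proof (induction rule: converse_rtrancl_induct)
  case (step a y)
  show ?case
  proof (cases "y \<in> B")
    case True
    then show ?thesis using step by (intro exI[of _ "[]"] exI[of _ y]) auto
  next
    case False
    then obtain p v where p: "distinct (y # p)" "set (y # p) \<inter> B = {}" "v \<in> B"
      "path_edges (y # p @ [v]) \<subseteq> E" using step by auto
    show ?thesis
    \<comment> \<open>If the walk revisits \<open>a\<close>, the loop is cut out by keeping only the
      part of the path from \<open>a\<close> on.\<close>
    proof (cases "a \<in> set (y # p)")
      case True
      then obtain xs ys where "y # p = xs @ a # ys" by (meson split_list)
      moreover from this have "path_edges (y # p @ [v]) = path_edges (xs @ [a]) \<union> path_edges (a # ys @ [v])"
        using path_edges_append[of xs a "ys @ [v]"] by (metis append_Cons append_assoc)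
      ultimately show ?thesis
        using p by (intro exI[of _ ys] exI[of _ v]) (auto simp del: set_simps simp flip: set_simps)
    next
      case False
      then show ?thesis using p step by (intro exI[of _ "y # p"] exI[of _ v]) auto
    qed
  qed
qed simp

lemma path_edges_subset_Pow: "e \<in> path_edges l \<Longrightarrow> e \<subseteq> set l"
  by (auto simp: path_edges_def)

text \<open>Connectedness yields an edge from some \<open>u\<close> in \<open>B\<close> to some
  \<open>w\<close> outside. Since \<open>G\<close> without \<open>u\<close> is still connected, a
  path leads from \<open>w\<close> back to \<open>B\<close>, and it must end at another vertex. The
  ear has \<open>w\<close> as an internal vertex, hence is not a chord.\<close>

lemma exists_ear:
  assumes G: "simple_graph G" "vertex_connected 2 G"
    and B: "B \<subset> verts G" "card B \<ge> 2"
  shows "\<exists>u v p. u \<in> B \<and> v \<in> B \<and> u \<noteq> v \<and> p \<noteq> [] \<and> distinct p \<and> set p \<inter> B = {} \<and>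
    set p \<subseteq> verts G \<and> path_edges (u # p @ [v]) \<subseteq> edges G"
proof -
  have conn: "connected_graph (delete_verts G X)" if "X \<subseteq> verts G" "card X < 2" for X
    using G(2) that by (simp add: vertex_connected_def)
  have G_conn: "connected_graph G"
    using conn[of "{}"] by (cases G) (simp add: delete_verts_def)
  obtain b z where "b \<in> B" "z \<in> verts G" "z \<notin> B"
    using B by (metis card.empty not_numeral_le_zero ex_in_conv psubset_imp_ex_mem DiffE)
  then have "(z, b) \<in> {(a, b). {a, b} \<in> edges G}\<^sup>*"
    using G_conn B(1) by (auto simp: connected_graph_def)
  from path_to_set[OF this \<open>z \<notin> B\<close> \<open>b \<in> B\<close>]
  obtain p0 u where p0: "set (z # p0) \<inter> B = {}" "u \<in> B" "path_edges (z # p0 @ [u]) \<subseteq> edges G"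
    by blast
  \<comment> \<open>\<open>w\<close> is the last vertex before the path enters
    \<open>B\<close>.\<close>
  obtain l w where lw: "z # p0 = l @ [w]" by (metis list.discI rev_exhaust)
  then have "path_edges (z # p0 @ [u]) = path_edges (l @ [w]) \<union> path_edges [w, u]"
    using path_edges_append[of l w "[u]"] by (metis append_Cons append_assoc append_Nil)
  then have wu: "{u, w} \<in> edges G" using p0 by (simp add: insert_commute)
  have w: "w \<notin> B" using lw p0(1) by (metis disjoint_iff in_set_conv_decomp)
  have "card (B - {u}) > 0"
    using B(2) p0(2) by (simp add: card_Diff_singleton_if)
  then obtain t where t: "t \<in> B" "t \<noteq> u" by (metis card_gt_0_iff Diff_iff ex_in_conv singletonI)
  let ?E = "edges (delete_verts G {u})"
  have "connected_graph (delete_verts G {u})" using p0(2) B(1) by (intro conn) auto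
  moreover have "w \<in> verts G" "w \<noteq> u" using simple_graphD(2)[OF G(1) wu] by auto
  ultimately have "(w, t) \<in> {(a, b). {a, b} \<in> ?E}\<^sup>*"
    using t B(1) unfolding connected_graph_def by (auto simp: delete_verts_def)
  from path_to_set[OF this w \<open>t \<in> B\<close>]
  obtain p v where p: "distinct (w # p)" "set (w # p) \<inter> B = {}" "v \<in> B"
    "path_edges (w # p @ [v]) \<subseteq> ?E" by blast
  have E: "?E \<subseteq> edges G" and Eu: "\<And>e. e \<in> ?E \<Longrightarrow> u \<notin> e"
    by (auto simp: delete_verts_def)
  \<comment> \<open>The end \<open>v\<close> lies on the last edge of the path, which is an edge of
    \<open>G\<close> without \<open>u\<close>; hence \<open>v\<close> differs from
    \<open>u\<close>.\<close>
  have "\<exists>e\<in>path_edges (l @ [c, d]). d \<in> e" for l and c d :: 'a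
    using path_edges_append[of l c "[d]"] by auto
  then have "\<exists>e\<in>path_edges (w # p @ [v]). v \<in> e"
    by (metis append_Cons append_assoc append_Nil list.discI rev_exhaust)
  then have "v \<noteq> u" using p(4) Eu by blast
  moreover have "set (w # p) \<subseteq> verts G"
  proof
    fix y assume "y \<in> set (w # p)"
    then obtain xs ys where y: "w # p = xs @ y # ys" by (meson split_list)
    then have "path_edges (w # p @ [v]) = path_edges (xs @ [y]) \<union> path_edges (y # ys @ [v])"
      using path_edges_append[of xs y "ys @ [v]"] by (metis append_Cons append_assoc)
    moreover have "\<exists>d. {y, d} \<in> path_edges (y # ys @ [v])" by (cases ys) auto
    ultimately show "y \<in> verts G" using p(4) E simple_graphD(2)[OF G(1)] by blast
  qed
  moreover have "path_edges (u # (w # p) @ [v]) \<subseteq> edges G" using wu p(4) E by auto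
  ultimately show ?thesis using p p0(2) by blast
qed

text \<open>Ears are added to the clique as long as a vertex is missing. Each has an internal
  vertex, so the number of missing vertices decreases.\<close>

lemma spanning_built_from_ears:
  assumes G: "simple_graph G" "vertex_connected 2 G"
    and K: "K \<subseteq> verts G" "clique K (edges G)" "card K \<ge> 2"
  shows "\<exists>r H. built_from_ears K r H \<and> verts H = verts G \<and> edges H \<subseteq> edges G"
proof -
  have finG: "finite (verts G)" using G(1) by (simp add: simple_graphD)
  then have finK: "finite K" using K(1) finite_subset by auto
  have extend: "\<exists>r H. built_from_ears K r H \<and> verts H = verts G \<and> edges H \<subseteq> edges G"
    if "built_from_ears K r H" "verts H \<subseteq> verts G" "edges H \<subseteq> edges G" for r H
    using that
  proof (induction "card (verts G) - card (verts H)" arbitrary: r H rule: less_induct)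
    case less
    have H: "simple_graph H" "K \<subseteq> verts H"
      using built_from_ears_simple[OF less.prems(1) finK] by auto
    show ?case
    proof (cases "verts H = verts G")
      case True
      then show ?thesis using less by blast
    next
      case False
      moreover have "card (verts H) \<ge> 2"
        using card_mono[of "verts H" K] H K(3) by (auto simp: simple_graphD)
      ultimately obtain u v p where ear: "u \<in> verts H" "v \<in> verts H" "u \<noteq> v" "p \<noteq> []" "distinct p"
        "set p \<inter> verts H = {}" "set p \<subseteq> verts G" "path_edges (u # p @ [v]) \<subseteq> edges G"
        using exists_ear[OF G, of "verts H"] less.prems(2) by blast
      let ?H = "add_ear H u p v"
      have sub: "verts ?H \<subseteq> verts G" "edges ?H \<subseteq> edges G"
        using ear less.prems by (auto simp: add_ear_def)
      have "card (verts ?H) = card (verts H) + length p"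
        using H ear by (intro card_verts_add_ear) auto
      moreover have "card (verts ?H) \<le> card (verts G)" using sub finG by (intro card_mono)
      moreover have "length p > 0" using ear by simp
      ultimately have "card (verts G) - card (verts ?H) < card (verts G) - card (verts H)"
        by linarith
      moreover have "built_from_ears K (Suc r) ?H"
        using less.prems(1) ear(1-6) by (rule built_from_ears.ear)
      ultimately show ?thesis using less.hyps sub by blast
    qed
  qed
  have "edges (complete_graph K) \<subseteq> edges G"
    using K(2) by (auto simp: complete_graph_def clique_def nsets_2_eq)
  then show ?thesis
    using extend[OF built_from_ears.clique] K(1) by (simp add: complete_graph_def)
qed

section \<open>Colorings in which two nonadjacent vertices agree\<close>

lemma extend_coloring_along_path:
  fixes c :: "'a \<Rightarrow> nat"
  assumes "x \<ge> 3" "distinct p" "u \<notin> set p" "v \<notin> set p" "p \<noteq> [] \<or> c u \<noteq> c v"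
  shows "\<exists>c'. (\<forall>a. a \<notin> set p \<longrightarrow> c' a = c a) \<and> c' ` set p \<subseteq> {1..x} \<and>
    (\<forall>a b. {a, b} \<in> path_edges (u # p @ [v]) \<longrightarrow> c' a \<noteq> c' b)"
  using assms
proof (induction p arbitrary: u c)
  case Nil
  then show ?case by (intro exI[of _ c]) (auto simp: doubleton_eq_iff)
next
  case (Cons w p)
  \<comment> \<open>Avoiding the color of \<open>v\<close> as well as that of \<open>u\<close>
    re-establishes the end condition of the induction hypothesis, even if \<open>w\<close> is the
    last internal vertex. Three colors suffice for this.\<close>
  have "card ({1..x} - {c u, c v}) > 0"
    using diff_card_le_card_Diff[of "{c u, c v}" "{1..x}"] card_insert_le_m1[of 2 "{c v}" "c u"]
      Cons.prems(1) by simp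
  then obtain d where d: "d \<in> {1..x}" "d \<noteq> c u" "d \<noteq> c v" by (metis card_gt_0_iff ex_in_conv DiffE insertCI)
  let ?c = "c(w := d)"
  have "p \<noteq> [] \<or> ?c w \<noteq> ?c v" using d Cons.prems by auto
  then obtain c' where c': "\<forall>a. a \<notin> set p \<longrightarrow> c' a = ?c a" "c' ` set p \<subseteq> {1..x}"
    "\<forall>a b. {a, b} \<in> path_edges (w # p @ [v]) \<longrightarrow> c' a \<noteq> c' b"
    using Cons.IH[of w ?c] Cons.prems by auto
  moreover have "c' u = c u" "c' w = d" using c'(1) Cons.prems by auto
  ultimately show ?case
    using d Cons.prems by (intro exI[of _ c']) (auto simp: doubleton_eq_iff)
qed

text \<open>Fixing the color \<open>d\<close> at \<open>s\<close> splits the path into two pieces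
  that are colored independently. Only an empty piece constrains \<open>d\<close>, as
  \<open>s\<close> is then adjacent to an end.\<close>

lemma extend_coloring_through:
  fixes c :: "'a \<Rightarrow> nat"
  assumes x: "x \<ge> 3" and p: "distinct (p1 @ s # p2)" "u \<notin> set (p1 @ s # p2)" "v \<notin> set (p1 @ s # p2)"
    and d: "d \<in> {1..x}" "p1 \<noteq> [] \<or> c u \<noteq> d" "p2 \<noteq> [] \<or> d \<noteq> c v"
  shows "\<exists>c'. (\<forall>a. a \<notin> set (p1 @ s # p2) \<longrightarrow> c' a = c a) \<and> c' ` set (p1 @ s # p2) \<subseteq> {1..x} \<and>
    (\<forall>a b. {a, b} \<in> path_edges (u # (p1 @ s # p2) @ [v]) \<longrightarrow> c' a \<noteq> c' b) \<and> c' s = d"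
proof -
  let ?c = "c(s := d)"
  obtain c1 where c1: "\<forall>a. a \<notin> set p1 \<longrightarrow> c1 a = ?c a" "c1 ` set p1 \<subseteq> {1..x}"
    "\<forall>a b. {a, b} \<in> path_edges (u # p1 @ [s]) \<longrightarrow> c1 a \<noteq> c1 b"
    using extend_coloring_along_path[of x p1 u s ?c] x p d by auto
  have c1s: "c1 s = d" "c1 v = c v" using c1(1) p by auto
  then obtain c2 where c2: "\<forall>a. a \<notin> set p2 \<longrightarrow> c2 a = c1 a" "c2 ` set p2 \<subseteq> {1..x}"
    "\<forall>a b. {a, b} \<in> path_edges (s # p2 @ [v]) \<longrightarrow> c2 a \<noteq> c2 b"
    using extend_coloring_along_path[of x p2 s v c1] x p d by auto
  have "c2 a \<noteq> c2 b" if "{a, b} \<in> path_edges (u # (p1 @ s # p2) @ [v])" for a b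
  proof -
    have "{a, b} \<in> path_edges (u # p1 @ [s]) \<or> {a, b} \<in> path_edges (s # p2 @ [v])"
      using that path_edges_append[of "u # p1" s "p2 @ [v]"] by simp
    then show ?thesis
    proof
      assume *: "{a, b} \<in> path_edges (u # p1 @ [s])"
      \<comment> \<open>Coloring the second piece does not touch the vertices of the first.\<close>
      then have "a \<notin> set p2" "b \<notin> set p2" using path_edges_subset_Pow[OF *] p by auto
      then show ?thesis using c1(3) c2(1) * by metis
    qed (use c2 in blast)
  qed
  moreover have "c2 a = c a" if "a \<notin> set (p1 @ s # p2)" for a
    using that c1(1) c2(1) by auto
  moreover have "c2 s = d" using c2(1) c1s p by auto
  moreover have "c2 a \<in> {1..x}" if "a \<in> set (p1 @ s # p2)" for a
  proof (cases "a \<in> set p2")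
    case True
    then show ?thesis using c2 by blast
  next
    case False
    then show ?thesis using that c1 c2(1) d(1) c1s by (cases "a = s") auto
  qed
  ultimately show ?thesis by (intro exI[of _ c2]) blast
qed

text \<open>A coloring of the clique is kept and only the ear is colored anew, with the common color
  prescribed in advance. Two clique vertices are always adjacent, so at least one of
  \<open>s\<close> and \<open>t\<close> is internal to the ear.\<close>

lemma agreeing_coloring_clique_add_ear:
  assumes K: "finite K" "card K \<le> x" "x \<ge> 3"
    and ear: "u \<in> K" "v \<in> K" "u \<noteq> v" "distinct p" "set p \<inter> K = {}"
    and st: "s \<in> K \<union> set p" "t \<in> K \<union> set p" "s \<noteq> t"
      "{s, t} \<notin> edges (add_ear (complete_graph K) u p v)"
  shows "agreeing_colorings (add_ear (complete_graph K) u p v) x s t \<noteq> {}"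
proof -
  let ?H = "add_ear (complete_graph K) u p v"
  have "int (chromatic_poly (complete_graph K) x) > 0"
    using K by (simp add: chromatic_poly_complete_graph falling_factorial_pos)
  then have "proper_colorings (complete_graph K) x \<noteq> {}" by (auto simp: chromatic_poly_def)
  then obtain c0 where c0: "c0 \<in> proper_colorings (complete_graph K) x" by blast
  have c0_inj: "c0 a \<noteq> c0 b" if "a \<in> K" "b \<in> K" "a \<noteq> b" for a b
    using c0 that by (auto simp: proper_colorings_def complete_graph_def)
  have c0_range: "c0 a \<in> {1..x}" if "a \<in> K" for a
    using c0 that by (auto simp: proper_colorings_def complete_graph_def)
  have uvp: "u \<notin> set p" "v \<notin> set p" using ear by auto
  have suff: "agreeing_colorings ?H x s t \<noteq> {}"
    if "\<forall>a. a \<notin> set p \<longrightarrow> c a = c0 a" "c ` set p \<subseteq> {1..x}"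
      "\<forall>a b. {a, b} \<in> path_edges (u # p @ [v]) \<longrightarrow> c a \<noteq> c b" "c s = c t" for c s t
  proof -
    have cK: "c a = c0 a" if "a \<in> K" for a using that \<open>\<forall>a. a \<notin> set p \<longrightarrow> c a = c0 a\<close> ear by auto
    have "c a \<noteq> c b" if "{a, b} \<in> edges ?H" for a b
      using that \<open>\<forall>a b. {a, b} \<in> path_edges (u # p @ [v]) \<longrightarrow> c a \<noteq> c b\<close> cK c0_inj
      by (auto simp: add_ear_def complete_graph_def simp del: path_edges_Cons_Cons)
    moreover have "c \<in> verts ?H \<rightarrow>\<^sub>E {1..x}"
    proof (rule PiE_I)
      fix a assume "a \<in> verts ?H"
      then show "c a \<in> {1..x}"
        using cK c0_range that(2) by (auto simp: add_ear_def complete_graph_def)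
    next
      fix a assume "a \<notin> verts ?H"
      then show "c a = undefined"
        using that(1) c0
        by (auto simp: add_ear_def complete_graph_def proper_colorings_def PiE_iff extensional_def)
    qed
    ultimately show ?thesis
      using that(4) by (auto simp: agreeing_colorings_def proper_colorings_def)
  qed
  \<comment> \<open>The ear vertex receives the color of the clique vertex \<open>s\<close>. If it
    is adjacent to an end of the ear, that end is not \<open>s\<close> and so has a different
    color.\<close>
  have mixed: "agreeing_colorings ?H x s t \<noteq> {}"
    if "s \<in> K" "t \<in> set p" "{s, t} \<notin> edges ?H" for s t
  proof -
    obtain p1 p2 where p: "p = p1 @ t # p2" using \<open>t \<in> set p\<close> by (meson split_list)
    have "path_edges (u # p @ [v]) = path_edges (u # p1 @ [t]) \<union> path_edges (t # p2 @ [v])"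
      using path_edges_append[of "u # p1" t "p2 @ [v]"] p by simp
    then have "{s, t} \<notin> path_edges (u # p1 @ [t])" "{s, t} \<notin> path_edges (t # p2 @ [v])"
      using that(3) by (auto simp: add_ear_def)
    then have "p1 \<noteq> [] \<or> u \<noteq> s" "p2 \<noteq> [] \<or> s \<noteq> v" by (auto simp: insert_commute)
    then have "p1 \<noteq> [] \<or> c0 u \<noteq> c0 s" "p2 \<noteq> [] \<or> c0 s \<noteq> c0 v"
      using c0_inj ear \<open>s \<in> K\<close> by blast+
    from extend_coloring_through[OF K(3) _ _ _ c0_range[OF \<open>s \<in> K\<close>] this, of t] ear uvp
    obtain c where c: "\<forall>a. a \<notin> set p \<longrightarrow> c a = c0 a" "c ` set p \<subseteq> {1..x}"
      "\<forall>a b. {a, b} \<in> path_edges (u # p @ [v]) \<longrightarrow> c a \<noteq> c b" "c t = c0 s"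
      unfolding p by blast
    moreover have "c s = c0 s" using c(1) \<open>s \<in> K\<close> ear by auto
    ultimately show ?thesis by (intro suff[of c]) auto
  qed
  \<comment> \<open>Both vertices receive a color \<open>d\<close> different from those of
    \<open>u\<close> and \<open>v\<close>. Nonadjacency guarantees an internal vertex between
    them.\<close>
  have inner: "agreeing_colorings ?H x s t \<noteq> {}"
    if p: "p = p1 @ s # p2 @ t # p3" and "{s, t} \<notin> edges ?H" for s t p1 p2 p3
  proof -
    have split: "path_edges (u # p @ [v])
        = path_edges (u # (p1 @ s # p2) @ [t]) \<union> path_edges (t # p3 @ [v])"
      using path_edges_append[of "u # p1 @ s # p2" t "p3 @ [v]"] p by simp
    moreover have "path_edges (u # (p1 @ s # p2) @ [t]) =
        path_edges (u # p1 @ [s]) \<union> path_edges (s # p2 @ [t])"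
      using path_edges_append[of "u # p1" s "p2 @ [t]"] by simp
    ultimately have "{s, t} \<notin> path_edges (s # p2 @ [t])"
      using that(2) by (auto simp: add_ear_def)
    then have p2: "p2 \<noteq> []" by auto
    have "card ({1..x} - {c0 u, c0 v}) > 0"
      using diff_card_le_card_Diff[of "{c0 u, c0 v}" "{1..x}"] card_insert_le_m1[of 2 "{c0 v}" "c0 u"]
        K(3) by simp
    then obtain d where d: "d \<in> {1..x}" "d \<noteq> c0 u" "d \<noteq> c0 v"
      by (metis card_gt_0_iff ex_in_conv DiffE insertCI)
    \<comment> \<open>Coloring \<open>t\<close> first makes it a fixed end, so the stretch from
      \<open>u\<close> through \<open>s\<close> to \<open>t\<close> falls under the previous lemma;
      the stretch from \<open>t\<close> to \<open>v\<close> follows separately.\<close>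
    let ?c = "c0(t := d)"
    have "p1 \<noteq> [] \<or> ?c u \<noteq> d" "p2 \<noteq> [] \<or> d \<noteq> ?c t" using p2 d uvp p by auto
    moreover have "distinct (p1 @ s # p2)" "u \<notin> set (p1 @ s # p2)" "t \<notin> set (p1 @ s # p2)"
      using ear(4) uvp p by auto
    ultimately obtain c1 where c1: "\<forall>a. a \<notin> set (p1 @ s # p2) \<longrightarrow> c1 a = ?c a" "c1 ` set (p1 @ s # p2) \<subseteq> {1..x}"
      "\<forall>a b. {a, b} \<in> path_edges (u # (p1 @ s # p2) @ [t]) \<longrightarrow> c1 a \<noteq> c1 b" "c1 s = d"
      using extend_coloring_through[of x p1 s p2 u t d ?c] K(3) d(1) by blast
    have c1t: "c1 t = d" "c1 v = c0 v" using c1(1) ear(4) uvp p by auto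
    then obtain c where c: "\<forall>a. a \<notin> set p3 \<longrightarrow> c a = c1 a" "c ` set p3 \<subseteq> {1..x}"
      "\<forall>a b. {a, b} \<in> path_edges (t # p3 @ [v]) \<longrightarrow> c a \<noteq> c b"
      using extend_coloring_along_path[of x p3 t v c1] K(3) ear(4) uvp p d by auto
    have "c a \<noteq> c b" if "{a, b} \<in> path_edges (u # p @ [v])" for a b
    proof -
      from that have "{a, b} \<in> path_edges (u # (p1 @ s # p2) @ [t]) \<or> {a, b} \<in> path_edges (t # p3 @ [v])"
        unfolding split by blast
      then show ?thesis
      proof
        assume *: "{a, b} \<in> path_edges (u # (p1 @ s # p2) @ [t])"
        then have "a \<notin> set p3" "b \<notin> set p3"
          using path_edges_subset_Pow[OF *] ear(4) uvp p by auto
        then show ?thesis using c1(3) c(1) * by metis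
      qed (use c in blast)
    qed
    moreover have "c a = c0 a" if "a \<notin> set p" for a
      using that c c1(1) p by auto
    moreover have "c a \<in> {1..x}" if "a \<in> set p" for a
    proof (cases "a \<in> set p3")
      case True
      then show ?thesis using c by blast
    next
      case False
      then have "a \<in> set (p1 @ s # p2) \<or> a = t" "c a = c1 a" using that p c by auto
      then show ?thesis using c1 d c1t by (metis image_subset_iff)
    qed
    moreover have "c s = c t" using c(1) c1t c1(4) ear(4) p by auto
    ultimately show ?thesis by (intro suff[of c]) auto
  qed
  have sym: "agreeing_colorings ?H x s t = agreeing_colorings ?H x t s" for s t
    by (auto simp: agreeing_colorings_def)
  have st': "{t, s} \<notin> edges ?H" using st(4) by (simp add: insert_commute)
  consider "s \<in> K" "t \<in> K" | "s \<in> K" "t \<in> set p" | "s \<in> set p" "t \<in> K" | "s \<in> set p" "t \<in> set p"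
    using st by auto
  then show ?thesis
  proof cases
    case 1
    then show ?thesis using st by (auto simp: add_ear_def complete_graph_def)
  next
    case 2
    then show ?thesis using mixed st by blast
  next
    case 3
    then show ?thesis using mixed[of t s] st' sym by auto
  next
    case 4
    obtain p1 p2 where p: "p = p1 @ s # p2" using 4 by (meson split_list)
    then have "t \<in> set p1 \<or> t \<in> set p2" using 4 st by auto
    then show ?thesis
    proof
      assume "t \<in> set p2"
      then obtain p3 p4 where "p2 = p3 @ t # p4" by (meson split_list)
      then show ?thesis using inner[of p1 s p3 t p4] p st by simp
    next
      assume "t \<in> set p1"
      then obtain p3 p4 where "p1 = p3 @ t # p4" by (meson split_list)
      then show ?thesis using inner[of p3 t p4 s p2] p st' sym by simp
    qed
  qed
qed

section \<open>Isomorphism with the extremal graph\<close>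

lemma clique_with_path_eq_add_ear:
  assumes "k < n"
  shows "clique_with_path n k = add_ear (complete_graph {..<k}) 0 [k..<n] 1"
proof -
  have "{..<n} = {..<k} \<union> set [k..<n]" using assms by auto
  then show ?thesis by (simp add: clique_with_path_def add_ear_def complete_graph_def)
qed

text \<open>Colorings are pulled back injectively along the isomorphism, with
  \<open>restrict\<close> keeping them extensional. In the equality case the reverse inequality
  comes from the general upper bound.\<close>

lemma graph_iso_chromatic_poly_le:
  assumes "graph_iso G H" "simple_graph G" "simple_graph H"
  shows "chromatic_poly H x \<le> chromatic_poly G x"
proof -
  obtain f where f: "bij_betw f (verts G) (verts H)"
    "\<forall>u\<in>verts G. \<forall>v\<in>verts G. {u, v} \<in> edges G \<longleftrightarrow> {f u, f v} \<in> edges H"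
    using assms(1) by (auto simp: graph_iso_def)
  let ?g = "\<lambda>c. restrict (c \<circ> f) (verts G)"
  have "inj_on ?g (proper_colorings H x)"
  proof (rule inj_onI)
    fix c d assume c: "c \<in> proper_colorings H x" "d \<in> proper_colorings H x" and eq: "?g c = ?g d"
    show "c = d"
    proof (rule PiE_ext)
      show "c \<in> verts H \<rightarrow>\<^sub>E {1..x}" "d \<in> verts H \<rightarrow>\<^sub>E {1..x}"
        using c by (auto simp: proper_colorings_def)
      fix y assume "y \<in> verts H"
      then obtain a where "a \<in> verts G" "y = f a" using f(1) by (auto simp: bij_betw_def)
      then show "c y = d y" using fun_cong[OF eq, of a] by simp
    qed
  qed
  moreover have "?g c \<in> proper_colorings G x" if c: "c \<in> proper_colorings H x" for c
  proof -
    have "c (f a) \<noteq> c (f b)" "a \<in> verts G" "b \<in> verts G" if "{a, b} \<in> edges G" for a b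
      using simple_graphD(2)[OF assms(2) that] f(2) c that by (auto simp: proper_colorings_def)
    moreover have "c (f a) \<in> {1..x}" if "a \<in> verts G" for a
      using that f(1) c by (auto simp: proper_colorings_def bij_betw_def PiE_iff)
    ultimately show ?thesis by (auto simp: proper_colorings_def)
  qed
  ultimately show ?thesis
    unfolding chromatic_poly_def using assms(2)
    by (intro card_inj_on_le[of ?g]) (auto simp: finite_proper_colorings simple_graphD)
qed

text \<open>Indexing a list gives a map from numbers to vertices, opposite to the direction in
  \<open>graph_iso\<close>; the inverse is taken here once.\<close>

lemma graph_iso_of_image:
  assumes h: "bij_betw h (verts H) (verts G)" and E: "edges G = (`) h ` edges H"
    and H: "simple_graph H"
  shows "graph_iso G H"
proof -
  let ?f = "the_inv_into (verts H) h"
  have inj: "inj_on h (verts H)" using h by (simp add: bij_betw_def)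
  have f: "bij_betw ?f (verts G) (verts H)" using h by (rule bij_betw_the_inv_into)
  have hf: "h (?f a) = a" if "a \<in> verts G" for a
    using h that by (metis f_the_inv_into_f_bij_betw)
  have mem: "e \<subseteq> verts H" if "e \<in> edges H" for e
    using that H by (auto simp: simple_graph_def nsets_def)
  have "{a, b} \<in> edges G \<longleftrightarrow> {?f a, ?f b} \<in> edges H" if "a \<in> verts G" "b \<in> verts G" for a b
  proof -
    have eq: "h ` {?f a, ?f b} = {a, b}" using hf that by simp
    have sub: "{?f a, ?f b} \<subseteq> verts H" using f that by (auto simp: bij_betw_def)
    show ?thesis
    proof
      assume "{a, b} \<in> edges G"
      then obtain e where "e \<in> edges H" "h ` e = h ` {?f a, ?f b}" using E eq by auto
      then show "{?f a, ?f b} \<in> edges H"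
        using inj_on_image_eq_iff[OF inj mem sub] by simp
    next
      assume "{?f a, ?f b} \<in> edges H"
      then show "{a, b} \<in> edges G" using E eq by (metis image_eqI)
    qed
  qed
  then show ?thesis using f by (auto simp: graph_iso_def)
qed

text \<open>The clique is enumerated with \<open>u\<close> and \<open>v\<close> first, followed by
  the ear; the position in this list is the isomorphism.\<close>

lemma clique_add_ear_iso:
  assumes K: "finite K" "card K = k"
    and ear: "u \<in> K" "v \<in> K" "u \<noteq> v" "p \<noteq> []" "distinct p" "set p \<inter> K = {}"
  shows "graph_iso (add_ear (complete_graph K) u p v) (clique_with_path (k + length p) k)"
proof -
  let ?n = "k + length p"
  obtain l where l: "set l = K - {u, v}" "distinct l"
    using K(1) finite_distinct_list[of "K - {u, v}"] by auto
  let ?L = "u # v # l"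
  have L: "set ?L = K" "distinct ?L" using l ear by auto
  then have len: "length ?L = k" using K(2) distinct_card by fastforce
  let ?h = "\<lambda>i. (?L @ p) ! i"
  have k2: "k \<ge> 2" using len by simp
  have "distinct (?L @ p)" using L ear by (metis distinct_append inf_commute)
  then have bij: "bij_betw ?h {..<?n} (K \<union> set p)"
    using L len by (intro bij_betw_nth) auto
  have "bij_betw ?h {..<k} K"
  proof -
    have "bij_betw ((!) ?L) {..<k} K" using L len by (intro bij_betw_nth) auto
    moreover have "?h i = ?L ! i" if "i \<in> {..<k}" for i
      using that len nth_append_left[of i ?L p] by simp
    ultimately show ?thesis by (subst bij_betw_cong) auto
  qed
  then have "(`) ?h ` [{..<k}]\<^bsup>2\<^esup> = [K]\<^bsup>2\<^esup>"
    using bij_betw_nsets[of ?h "{..<k}" K 2] by (simp add: bij_betw_def)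
  \<comment> \<open>Positions 0 and 1 hold \<open>u\<close> and \<open>v\<close>, and the positions
    from \<open>k\<close> on hold \<open>p\<close>.\<close>
  moreover have "map ?h (0 # [k..<?n] @ [1]) = u # p @ [v]"
  proof -
    have "map ?h [k..<?n] = p"
      using len by (intro nth_equalityI) (auto simp: nth_append)
    then show ?thesis by simp
  qed
  then have "(`) ?h ` path_edges (0 # [k..<?n] @ [1]) = path_edges (u # p @ [v])"
    using path_edges_map[of ?h "0 # [k..<?n] @ [1]"] by simp
  moreover have n: "k < ?n" using ear by simp
  moreover have "simple_graph (clique_with_path ?n k)"
    unfolding clique_with_path_eq_add_ear[OF n] using k2
    by (intro simple_add_ear simple_complete_graph) (auto simp: complete_graph_def)
  ultimately show ?thesis
    using bij by (intro graph_iso_of_image[of ?h])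
      (simp_all add: clique_with_path_def add_ear_def complete_graph_def image_Un)
qed

section \<open>The bound and its equality case\<close>

theorem theorem2p8:
  fixes G :: "'a sgraph" and n k x :: nat
  assumes "k \<ge> 4" and "n > k"
    and "simple_graph G"
    and "card (verts G) = n"
    and "vertex_connected 2 G"
    and "chromatic_number G = k"
    and "clique_number G = k"
    and "x \<ge> k"
  shows "int (chromatic_poly G x)
           \<le> falling_factorial (int x - 1) (k - 1) * ((int x - 1) ^ (n - k + 1) + (- 1) ^ (n - k))
       \<and> (int (chromatic_poly G x)
           = falling_factorial (int x - 1) (k - 1) * ((int x - 1) ^ (n - k + 1) + (- 1) ^ (n - k))
         \<longleftrightarrow> graph_iso G (clique_with_path n k))"
proof -
  define B where "B = falling_factorial (int x - 1) (k - 1) * ((int x - 1) ^ (n - k + 1) + (- 1) ^ (n - k))"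
  have B: "falling_factorial (int x) k * walk_count (int x - 1) (n - k) = B"
  proof -
    have "falling_factorial (int x) k = int x * falling_factorial (int x - 1) (k - 1)"
      using falling_factorial_Suc[of "int x" "k - 1"] assms(1) by simp
    moreover have "int x * walk_count (int x - 1) (n - k) = (int x - 1) ^ (n - k + 1) + (- 1) ^ (n - k)"
      using walk_count_closed[of "int x - 1" "n - k"] by simp
    ultimately show ?thesis unfolding B_def by (metis mult.assoc mult.commute)
  qed
  have finG: "finite (verts G)" using assms(3) by (simp add: simple_graphD)
  have "clique_number G \<in> {card K | K. K \<subseteq> verts G \<and> clique K (edges G)}"
    unfolding clique_number_def
  proof (rule Max_in)
    have "{card K | K. K \<subseteq> verts G \<and> clique K (edges G)} \<subseteq> card ` Pow (verts G)" by auto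
    then show "finite {card K | K. K \<subseteq> verts G \<and> clique K (edges G)}"
      using finG by (meson finite_Pow_iff finite_imageI finite_subset)
    show "{card K | K. K \<subseteq> verts G \<and> clique K (edges G)} \<noteq> {}"
      by (auto simp: clique_def intro!: exI[of _ "{}"])
  qed
  then obtain K where K: "K \<subseteq> verts G" "clique K (edges G)" "card K = k"
    using assms(7) by auto
  have finK: "finite K" using K(1) finG finite_subset by auto
  have F: "int (chromatic_poly (complete_graph K) x) = falling_factorial (int x) k"
    using chromatic_poly_complete_graph[OF finK, of x] K(3) assms by simp
  obtain r H where H: "built_from_ears K r H" "verts H = verts G" "edges H \<subseteq> edges G"
    using spanning_built_from_ears[OF assms(3,5) K(1,2)] K(3) assms(1) by auto
  have PH: "int (chromatic_poly H x) \<le> B" "r \<ge> 2 \<Longrightarrow> int (chromatic_poly H x) < B"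
    using chromatic_poly_built_from_ears[OF H(1) finK, of x] K(3) assms(1,4,8) F B H(2) by auto
  have sub: "proper_colorings G x \<subseteq> proper_colorings H x"
    using H by (intro proper_colorings_antimono)
  have finH: "finite (proper_colorings H x)"
    using H(2) finG by (simp add: finite_proper_colorings)
  have PG: "chromatic_poly G x \<le> chromatic_poly H x"
    unfolding chromatic_poly_def by (intro card_mono finH sub)
  have extremal: "int (chromatic_poly (clique_with_path n k) x) = B"
    and simple_extremal: "simple_graph (clique_with_path n k)"
  proof -
    have "int (chromatic_poly (complete_graph {..<k}) x) = falling_factorial (int x) k"
      using chromatic_poly_complete_graph[of "{..<k}" x] assms(8) by simp
    moreover have "{k..<n} \<inter> {..<k} = {}" by auto
    ultimately show "int (chromatic_poly (clique_with_path n k) x) = B"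
      using chromatic_poly_clique_add_ear[of "{..<k}" 0 1 "[k..<n]" x] assms(1,8) B
      by (simp add: clique_with_path_eq_add_ear[OF assms(2)])
    show "simple_graph (clique_with_path n k)"
      unfolding clique_with_path_eq_add_ear[OF assms(2)] using assms(1)
      by (intro simple_add_ear simple_complete_graph) (auto simp: complete_graph_def)
  qed
  have iso_ge: "int (chromatic_poly G x) \<ge> B" if "graph_iso G (clique_with_path n k)"
    using graph_iso_chromatic_poly_le[OF that assms(3) simple_extremal, of x] extremal by simp
  have "int (chromatic_poly G x) = B \<longrightarrow> graph_iso G (clique_with_path n k)"
  proof
    assume eq: "int (chromatic_poly G x) = B"
    \<comment> \<open>With two or more ears the bound for \<open>H\<close>, and hence for
      \<open>G\<close>, is strict.\<close>
    then have "r < 2" using PH PG by fastforce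
    moreover have "r \<noteq> 0"
    proof
      assume "r = 0"
      then have "verts G = K" using built_from_ears_0[of K H] H by (simp add: complete_graph_def)
      then show False using K(3) assms(2,4) by simp
    qed
    ultimately have "r = Suc 0" by simp
    with H(1) obtain H0 u v p where "built_from_ears K 0 H0" "H = add_ear H0 u p v"
      "u \<in> verts H0" "v \<in> verts H0" "u \<noteq> v" "p \<noteq> []" "distinct p" "set p \<inter> verts H0 = {}"
      by (auto elim: built_from_ears.cases)
    then have ear: "H = add_ear (complete_graph K) u p v" "u \<in> K" "v \<in> K" "u \<noteq> v" "p \<noteq> []"
      "distinct p" "set p \<inter> K = {}"
      using built_from_ears_0[of K H0] by (auto simp: complete_graph_def)
    \<comment> \<open>An edge of \<open>G\<close> missing in \<open>H\<close> would exclude a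
      coloring of \<open>H\<close> in which its ends agree, and \<open>G\<close> would fall below
      the bound.\<close>
    have "edges G \<subseteq> edges H"
    proof
      fix e assume e: "e \<in> edges G"
      then have "e \<in> [verts G]\<^bsup>2\<^esup>" using assms(3) by (auto simp: simple_graph_def)
      then obtain s t where st: "e = {s, t}" "s \<in> verts G" "t \<in> verts G" "s \<noteq> t"
        by (meson nsets2_E)
      show "e \<in> edges H"
      proof (rule ccontr)
        assume "e \<notin> edges H"
        then have "agreeing_colorings H x s t \<noteq> {}"
          unfolding ear(1) using ear st H(2) K(3) assms(1,8) finK
          by (intro agreeing_coloring_clique_add_ear) (auto simp: add_ear_def complete_graph_def)
        then obtain c where "c \<in> proper_colorings H x" "c s = c t"
          by (auto simp: agreeing_colorings_def)
        moreover have "c \<notin> proper_colorings G x"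
          using \<open>c s = c t\<close> e st(1) by (auto simp: proper_colorings_def)
        ultimately have "proper_colorings G x \<subset> proper_colorings H x" using sub by blast
        then have "chromatic_poly G x < chromatic_poly H x"
          unfolding chromatic_poly_def using finH by (rule psubset_card_mono[rotated])
        then show False using eq PH(1) by linarith
      qed
    qed
    then have "G = H" using H by (auto intro: sgraph.equality)
    moreover have "n = k + length p"
      using card_verts_add_ear[of "complete_graph K" p u v] ear simple_complete_graph[OF finK]
        H(2) K(3) assms(4) by (simp add: complete_graph_def)
    ultimately show "graph_iso G (clique_with_path n k)"
      using clique_add_ear_iso[OF finK K(3) ear(2-7)] ear(1) by simp
  qed
  then show ?thesis using iso_ge PH(1) PG unfolding B_def by fastforce
qed

end
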